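(* Let $R$ be a semiprime ring. Then the set $rAnn(id(R))$ of right annihilator ideals of $R$, partially ordered by inclusion, is a frame.
   Context: $R$ is a nonzero associative ring with identity; "ideal" means two-sided ideal. For $X\subseteq R$, $l(X)=\{r\in R: rX=0\}$ and $r(X)=\{r\in R: Xr=0\}$. An ideal $I$ of $R$ is a right annihilator ideal if $r(l(I))=I$; $rAnn(id(R))$ is the set of all right annihilator ideals of $R$. Ordered by inclusion it is a complete lattice with $I\wedge J=I\cap J$ and $I\vee J=r(l(I)\cap l(J))$ (and arbitrary joins $\bigvee_{\alpha} I_\alpha=r(l(\sum_\alpha I_\alpha))$). A frame is a complete lattice $L$ satisfying $(\bigvee A)\wedge b=\bigvee\{a\wedge b: a\in A\}$ for every $A\subseteq L$ and $b\in L$. *)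

theory Defs
  imports "HOL-Algebra.Ideal_Product" "HOL-Algebra.Complete_Lattice"
begin

text \<open>
  A ring is semiprime if it has no nonzero ideal of square zero, equivalently no nonzero
  nilpotent ideal. Here \<open>ideal_prod R I J\<close> is the usual product of ideals, consisting
  of the finite sums of products \<open>i \<otimes> j\<close>.
\<close>

locale semiprime_ring = ring R for R (structure) +
  assumes semiprime: "\<lbrakk>ideal I R; ideal_prod R I I = {\<zero>}\<rbrakk> \<Longrightarrow> I = {\<zero>}"

definition left_ann :: "('a, 'm) ring_scheme \<Rightarrow> 'a set \<Rightarrow> 'a set" where
  "left_ann R X = {r \<in> carrier R. \<forall>x\<in>X. r \<otimes>\<^bsub>R\<^esub> x = \<zero>\<^bsub>R\<^esub>}"

definition right_ann :: "('a, 'm) ring_scheme \<Rightarrow> 'a set \<Rightarrow> 'a set" where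
  "right_ann R X = {r \<in> carrier R. \<forall>x\<in>X. x \<otimes>\<^bsub>R\<^esub> r = \<zero>\<^bsub>R\<^esub>}"

definition right_ann_ideals :: "('a, 'm) ring_scheme \<Rightarrow> 'a set set" where
  "right_ann_ideals R = {I. ideal I R \<and> right_ann R (left_ann R I) = I}"

definition right_ann_order :: "('a, 'm) ring_scheme \<Rightarrow> 'a set gorder" where
  "right_ann_order R = \<lparr>carrier = right_ann_ideals R, eq = (=), le = (\<subseteq>)\<rparr>"

locale frame = complete_lattice L for L (structure) +
  assumes sup_meet_distrib:
    "\<lbrakk>A \<subseteq> carrier L; b \<in> carrier L\<rbrakk> \<Longrightarrow> (\<Squnion>A) \<sqinter> b = \<Squnion>((\<lambda>a. a \<sqinter> b) ` A)"

end

theory Submission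
  imports Defs
begin

text \<open>
  In a semiprime ring, ideals \<open>I\<close>, \<open>J\<close> with \<open>IJ = 0\<close> meet trivially, because \<open>I \<inter> J\<close> has square
  zero. Given right annihilator ideals \<open>a \<in> A\<close> and \<open>b\<close>, let \<open>T\<close> be the left annihilator of
  all \<open>a \<inter> b\<close>. Then \<open>T \<inter> b\<close> meets every \<open>a\<close> trivially, so it annihilates every \<open>a\<close>, and hence
  also \<open>\<Or>A = r(l(\<Union>A))\<close>. Applying the first remark to \<open>T \<inter> b\<close> and \<open>\<Or>A\<close> gives
  \<open>T (\<Or>A \<inter> b) \<subseteq> T \<inter> b \<inter> \<Or>A = 0\<close>, that is, \<open>\<Or>A \<inter> b \<subseteq> r(T)\<close>, the join of all \<open>a \<inter> b\<close>.
\<close>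

section \<open>Annihilators as an antitone Galois connection on subsets\<close>

lemma left_annI:
  "r \<in> carrier R \<Longrightarrow> (\<And>x. x \<in> X \<Longrightarrow> r \<otimes>\<^bsub>R\<^esub> x = \<zero>\<^bsub>R\<^esub>) \<Longrightarrow> r \<in> left_ann R X"
  by (simp add: left_ann_def)

lemma right_annI:
  "r \<in> carrier R \<Longrightarrow> (\<And>x. x \<in> X \<Longrightarrow> x \<otimes>\<^bsub>R\<^esub> r = \<zero>\<^bsub>R\<^esub>) \<Longrightarrow> r \<in> right_ann R X"
  by (simp add: right_ann_def)

lemma left_ann_antimono: "X \<subseteq> Y \<Longrightarrow> left_ann R Y \<subseteq> left_ann R X"
  by (auto simp: left_ann_def)

lemma right_ann_antimono: "X \<subseteq> Y \<Longrightarrow> right_ann R Y \<subseteq> right_ann R X"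
  by (auto simp: right_ann_def)

lemma subset_right_left_ann: "X \<subseteq> carrier R \<Longrightarrow> X \<subseteq> right_ann R (left_ann R X)"
  by (auto simp: left_ann_def right_ann_def)

text \<open>Triple annihilators collapse as in any antitone Galois connection: \<open>X\<close> lies
  in l(r(X)), and applying r reverses this; the other inclusion is the closure property at
  r(X).\<close>

lemma right_left_right_ann:
  assumes "X \<subseteq> carrier R"
  shows "right_ann R (left_ann R (right_ann R X)) = right_ann R X"
proof
  have "X \<subseteq> left_ann R (right_ann R X)"
    using assms by (auto simp: left_ann_def right_ann_def)
  then show "right_ann R (left_ann R (right_ann R X)) \<subseteq> right_ann R X"
    by (rule right_ann_antimono)
  show "right_ann R X \<subseteq> right_ann R (left_ann R (right_ann R X))"
    by (rule subset_right_left_ann) (auto simp: right_ann_def)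
qed

section \<open>The complete lattice of right annihilator ideals\<close>

context ring
begin

text \<open>A left annihilator is always a left ideal. If \<open>X\<close> absorbs left
  multiplication, it is also a right ideal, because (rs)x = r(sx) and sx is again in
  \<open>X\<close>.\<close>

lemma left_ann_ideal:
  assumes "X \<subseteq> carrier R" and "\<And>r x. r \<in> carrier R \<Longrightarrow> x \<in> X \<Longrightarrow> r \<otimes> x \<in> X"
  shows "ideal (left_ann R X) R"
proof (rule idealI[OF ring_axioms])
  show "subgroup (left_ann R X) (add_monoid R)"
    using assms(1) by (intro add.subgroupI) (auto simp: left_ann_def subset_iff l_distr l_minus)
qed (use assms in \<open>auto simp: left_ann_def subset_iff m_assoc\<close>)

lemma right_ann_ideal:
  assumes "X \<subseteq> carrier R" and "\<And>r x. r \<in> carrier R \<Longrightarrow> x \<in> X \<Longrightarrow> x \<otimes> r \<in> X"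
  shows "ideal (right_ann R X) R"
proof (rule idealI[OF ring_axioms])
  show "subgroup (right_ann R X) (add_monoid R)"
    using assms(1) by (intro add.subgroupI) (auto simp: right_ann_def subset_iff r_distr r_minus)
qed (use assms in \<open>auto simp: right_ann_def subset_iff simp flip: m_assoc\<close>)

lemma ideal_subset_carrier: "ideal I R \<Longrightarrow> I \<subseteq> carrier R"
  by (auto intro: ideal.Icarr)

text \<open>The union stands in for the sum of the ideals: it has the same left annihilator, and it
  still absorbs left multiplication.\<close>

lemma left_ann_Union_ideal:
  assumes "\<And>I. I \<in> A \<Longrightarrow> ideal I R"
  shows "ideal (left_ann R (\<Union>A)) R"
  by (rule left_ann_ideal) (use assms in \<open>auto intro: ideal.Icarr ideal.I_l_closed\<close>)

text \<open>Applied to the ideal l(\<open>\<Union>A\<close>), this shows that the join formula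
  r(l(\<open>\<Union>A\<close>)) yields a right annihilator ideal.\<close>

lemma right_ann_in_right_ann_ideals:
  assumes "ideal I R"
  shows "right_ann R I \<in> right_ann_ideals R"
  unfolding right_ann_ideals_def
  using right_left_right_ann[of I R] right_ann_ideal[of I] ideal_subset_carrier[OF assms]
    ideal.I_r_closed[OF assms] by simp

text \<open>The operator r(l(-)) is monotone and fixes every \<open>a\<close> in \<open>A\<close>,
  so the closure of the intersection stays inside each \<open>a\<close>. Cutting with
  \<open>carrier R\<close> gives the top element for empty \<open>A\<close>, where
  \<open>\<Inter>A\<close> is the whole type.\<close>

lemma Inter_in_right_ann_ideals:
  assumes "A \<subseteq> right_ann_ideals R"
  shows "carrier R \<inter> \<Inter>A \<in> right_ann_ideals R" (is "?I \<in> _")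
proof -
  \<comment> \<open>Inserting the unit ideal makes the family nonempty, as
    \<open>i_Intersect\<close> demands.\<close>
  have "ideal (\<Inter>(insert (carrier R) A)) R"
    by (rule i_Intersect) (use assms in \<open>auto simp: right_ann_ideals_def oneideal\<close>)
  moreover have "right_ann R (left_ann R ?I) \<subseteq> a" if "a \<in> A" for a
  proof -
    have "right_ann R (left_ann R ?I) \<subseteq> right_ann R (left_ann R a)"
      using that by (intro right_ann_antimono left_ann_antimono) auto
    then show ?thesis
      using assms that by (auto simp: right_ann_ideals_def)
  qed
  moreover have "right_ann R (left_ann R ?I) \<subseteq> carrier R"
    by (auto simp: right_ann_def)
  ultimately show ?thesis
    using subset_right_left_ann[of ?I R] by (auto simp: right_ann_ideals_def)
qed

lemma right_ann_order_partial_order: "partial_order (right_ann_order R)"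
  by unfold_locales (auto simp: right_ann_order_def)

text \<open>The join is the closure of the union: an upper bound \<open>c\<close> is closed, so it
  contains r(l(\<open>\<Union>A\<close>)) as soon as it contains \<open>\<Union>A\<close>.\<close>

lemma right_ann_order_lub:
  assumes "A \<subseteq> right_ann_ideals R"
  shows "least (right_ann_order R) (right_ann R (left_ann R (\<Union>A))) (Upper (right_ann_order R) A)"
proof (rule least_UpperI)
  have ideals: "ideal I R" if "I \<in> A" for I
    using assms that by (auto simp: right_ann_ideals_def)
  show "right_ann R (left_ann R (\<Union>A)) \<in> carrier (right_ann_order R)"
    using ideals
    by (simp add: right_ann_order_def right_ann_in_right_ann_ideals left_ann_Union_ideal)
  show "a \<sqsubseteq>\<^bsub>right_ann_order R\<^esub> right_ann R (left_ann R (\<Union>A))" if "a \<in> A" for a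
  proof -
    have "\<Union>A \<subseteq> right_ann R (left_ann R (\<Union>A))"
      by (rule subset_right_left_ann) (use ideals in \<open>auto intro: ideal.Icarr\<close>)
    then show ?thesis
      using that by (auto simp: right_ann_order_def)
  qed
  show "right_ann R (left_ann R (\<Union>A)) \<sqsubseteq>\<^bsub>right_ann_order R\<^esub> c"
    if "c \<in> Upper (right_ann_order R) A" for c
  proof -
    have c: "c \<in> right_ann_ideals R" "\<Union>A \<subseteq> c"
      using that assms by (auto simp: right_ann_order_def Upper_def)
    then have "right_ann R (left_ann R (\<Union>A)) \<subseteq> right_ann R (left_ann R c)"
      by (intro right_ann_antimono left_ann_antimono)
    with c show ?thesis
      by (simp add: right_ann_order_def right_ann_ideals_def)
  qed
qed (use assms in \<open>simp add: right_ann_order_def\<close>)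

lemma right_ann_order_glb:
  assumes "A \<subseteq> right_ann_ideals R"
  shows "greatest (right_ann_order R) (carrier R \<inter> \<Inter>A) (Lower (right_ann_order R) A)"
proof (rule greatest_LowerI)
  show "c \<sqsubseteq>\<^bsub>right_ann_order R\<^esub> carrier R \<inter> \<Inter>A" if "c \<in> Lower (right_ann_order R) A" for c
  proof -
    have "ideal c R" and "\<And>a. a \<in> A \<Longrightarrow> c \<subseteq> a"
      using that assms by (auto simp: right_ann_order_def Lower_def right_ann_ideals_def subset_iff)
    then show ?thesis
      using ideal_subset_carrier by (auto simp: right_ann_order_def)
  qed
qed (use assms Inter_in_right_ann_ideals in \<open>auto simp: right_ann_order_def\<close>)

lemma right_ann_order_complete_lattice: "complete_lattice (right_ann_order R)"
proof (rule partial_order.complete_latticeI[OF right_ann_order_partial_order])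
  fix A
  assume "A \<subseteq> carrier (right_ann_order R)"
  then have "A \<subseteq> right_ann_ideals R"
    by (simp add: right_ann_order_def)
  then show "\<exists>s. least (right_ann_order R) s (Upper (right_ann_order R) A)"
    and "\<exists>i. greatest (right_ann_order R) i (Lower (right_ann_order R) A)"
    using right_ann_order_lub right_ann_order_glb by blast+
qed

lemma right_ann_order_sup:
  assumes "A \<subseteq> right_ann_ideals R"
  shows "\<Squnion>\<^bsub>right_ann_order R\<^esub> A = right_ann R (left_ann R (\<Union>A))"
proof -
  interpret complete_lattice "right_ann_order R"
    by (rule right_ann_order_complete_lattice)
  show ?thesis
    \<comment> \<open>The supremum is a Hilbert choice among least upper bounds; uniqueness
      identifies it with the one exhibited above.\<close>
    unfolding sup_def
    by (rule some_equality) (use right_ann_order_lub[OF assms] least_unique in blast)+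
qed

lemma right_ann_order_meet:
  assumes "a \<in> right_ann_ideals R" and "b \<in> right_ann_ideals R"
  shows "a \<sqinter>\<^bsub>right_ann_order R\<^esub> b = a \<inter> b"
proof -
  interpret complete_lattice "right_ann_order R"
    by (rule right_ann_order_complete_lattice)
  have "carrier R \<inter> \<Inter>{a, b} = a \<inter> b"
    using assms ideal_subset_carrier by (auto simp: right_ann_ideals_def)
  then have glb: "greatest (right_ann_order R) (a \<inter> b) (Lower (right_ann_order R) {a, b})"
    using right_ann_order_glb[of "{a, b}"] assms by simp
  show ?thesis
    unfolding meet_def inf_def
    by (rule some_equality) (use glb greatest_unique in blast)+
qed

lemma inter_in_right_ann_ideals:
  assumes "a \<in> right_ann_ideals R" and "b \<in> right_ann_ideals R"
  shows "a \<inter> b \<in> right_ann_ideals R"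
proof -
  have "carrier R \<inter> \<Inter>{a, b} = a \<inter> b"
    using assms ideal_subset_carrier by (auto simp: right_ann_ideals_def)
  then show ?thesis
    using Inter_in_right_ann_ideals[of "{a, b}"] assms by simp
qed

end

section \<open>Semiprimeness and the infinite distributive law\<close>

context semiprime_ring
begin

lemma ideal_inter_eq_zero:
  assumes "ideal I R" and "ideal J R"
    and mult_zero: "\<And>x y. x \<in> I \<Longrightarrow> y \<in> J \<Longrightarrow> x \<otimes> y = \<zero>"
  shows "I \<inter> J = {\<zero>}"
proof (rule semiprime)
  show IJ: "ideal (I \<inter> J) R"
    using assms(1,2) by (rule i_intersect)
  \<comment> \<open>The product is generated by sums from products whose left factor lies in
    \<open>I\<close> and right factor in \<open>J\<close>, all of them zero.\<close>
  have "x = \<zero>" if "x \<in> ideal_prod R (I \<inter> J) (I \<inter> J)" for x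
    using that by induction (auto simp: mult_zero)
  moreover have "\<zero> \<in> ideal_prod R (I \<inter> J) (I \<inter> J)"
    using ideal_prod_is_ideal[OF IJ IJ]
    by (simp add: additive_subgroup.zero_closed ideal.axioms(1))
  ultimately show "ideal_prod R (I \<inter> J) (I \<inter> J) = {\<zero>}"
    by blast
qed

lemma right_left_ann_Union_inter_subset:
  assumes ideals: "\<And>a. a \<in> A \<Longrightarrow> ideal a R" and b: "ideal b R"
  shows "right_ann R (left_ann R (\<Union>A)) \<inter> b
    \<subseteq> right_ann R (left_ann R (\<Union>a\<in>A. a \<inter> b))" (is "?S \<inter> b \<subseteq> right_ann R ?T")
proof -
  have T: "ideal ?T R"
    by (rule left_ann_Union_ideal) (auto intro: i_intersect ideals b)
  have Tb: "ideal (?T \<inter> b) R"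
    using T b by (rule i_intersect)
  have S: "ideal ?S R"
    using right_ann_in_right_ann_ideals[OF left_ann_Union_ideal] ideals
    by (simp add: right_ann_ideals_def)
  have "?T \<inter> b \<subseteq> left_ann R (\<Union>A)"
  proof
    fix t assume t: "t \<in> ?T \<inter> b"
    show "t \<in> left_ann R (\<Union>A)"
    proof (rule left_annI)
      show tc: "t \<in> carrier R"
        using Tb t by (rule ideal.Icarr)
      fix x assume "x \<in> \<Union>A"
      then obtain a where a: "a \<in> A" "x \<in> a" by blast
      \<comment> \<open>By its definition \<open>?T\<close> kills \<open>a \<inter> b\<close>. The
        product \<open>t \<otimes> x\<close> lies in \<open>?T \<inter> b\<close> through its left
        factor and in \<open>a\<close> through its right one.\<close>
      have "?T \<inter> (a \<inter> b) = {\<zero>}"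
        by (rule ideal_inter_eq_zero[OF T i_intersect[OF ideals[OF a(1)] b]])
          (use a(1) in \<open>auto simp: left_ann_def\<close>)
      moreover have "t \<otimes> x \<in> ?T \<inter> b"
        by (rule ideal.I_r_closed[OF Tb t ideal.Icarr[OF ideals[OF a(1)] a(2)]])
      moreover have "t \<otimes> x \<in> a"
        by (rule ideal.I_l_closed[OF ideals[OF a(1)] a(2) tc])
      ultimately show "t \<otimes> x = \<zero>"
        by blast
    qed
  qed
  \<comment> \<open>\<open>?S\<close> is killed from the left by all of l(\<open>\<Union>A\<close>),
    in particular by \<open>?T \<inter> b\<close>.\<close>
  then have disj: "(?T \<inter> b) \<inter> ?S = {\<zero>}"
    by (intro ideal_inter_eq_zero[OF Tb S]) (auto simp: right_ann_def)
  show ?thesis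
  proof
    fix x assume x: "x \<in> ?S \<inter> b"
    show "x \<in> right_ann R ?T"
    proof (rule right_annI)
      show xc: "x \<in> carrier R"
        using b x by (blast intro: ideal.Icarr[of b])
      fix t assume t: "t \<in> ?T"
      have tc: "t \<in> carrier R"
        using T t by (rule ideal.Icarr)
      \<comment> \<open>Membership in \<open>?T\<close> comes from \<open>t\<close>; membership in
        \<open>b\<close> and \<open>?S\<close> comes from \<open>x\<close>.\<close>
      have "t \<otimes> x \<in> (?T \<inter> b) \<inter> ?S"
        using x ideal.I_r_closed[OF T t xc] ideal.I_l_closed[OF b _ tc] ideal.I_l_closed[OF S _ tc]
        by simp
      then show "t \<otimes> x = \<zero>"
        using disj by blast
    qed
  qed
qed

end

theorem theorem5p3:
  fixes R :: "('a, 'm) ring_scheme"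
  assumes "semiprime_ring R"
    and "\<one>\<^bsub>R\<^esub> \<noteq> \<zero>\<^bsub>R\<^esub>"
  shows "frame (right_ann_order R)"
proof -
  interpret semiprime_ring R by fact
  let ?L = "right_ann_order R"
  interpret L: complete_lattice ?L
    by (rule right_ann_order_complete_lattice)
  show ?thesis
  proof unfold_locales
    fix A b
    assume "A \<subseteq> carrier ?L" and "b \<in> carrier ?L"
    then have A: "A \<subseteq> right_ann_ideals R" and b: "b \<in> right_ann_ideals R"
      by (simp_all add: right_ann_order_def)
    have inter: "(\<lambda>a. a \<inter> b) ` A \<subseteq> right_ann_ideals R"
      using A b inter_in_right_ann_ideals by blast
    \<comment> \<open>This lets the outer meet be computed as an intersection, which turns the frame
      law into an equation of sets.\<close>
    have sup: "\<Squnion>\<^bsub>?L\<^esub> A \<in> right_ann_ideals R"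
      using L.sup_closed[of A] A by (simp add: right_ann_order_def)
    have "\<Squnion>\<^bsub>?L\<^esub> A \<inter> b = \<Squnion>\<^bsub>?L\<^esub> ((\<lambda>a. a \<inter> b) ` A)"
    proof
      show "\<Squnion>\<^bsub>?L\<^esub> A \<inter> b \<subseteq> \<Squnion>\<^bsub>?L\<^esub> ((\<lambda>a. a \<inter> b) ` A)"
        unfolding right_ann_order_sup[OF A] right_ann_order_sup[OF inter]
        by (rule right_left_ann_Union_inter_subset) (use A b in \<open>auto simp: right_ann_ideals_def\<close>)
      \<comment> \<open>The easy inclusion is monotonicity of r(l(-)), together with
        r(l(\<open>b\<close>)) = \<open>b\<close>.\<close>
      have "right_ann R (left_ann R (\<Union>a\<in>A. a \<inter> b)) \<subseteq> right_ann R (left_ann R (\<Union>A))"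
        "right_ann R (left_ann R (\<Union>a\<in>A. a \<inter> b)) \<subseteq> right_ann R (left_ann R b)"
        by (intro right_ann_antimono left_ann_antimono; blast)+
      then show "\<Squnion>\<^bsub>?L\<^esub> ((\<lambda>a. a \<inter> b) ` A) \<subseteq> \<Squnion>\<^bsub>?L\<^esub> A \<inter> b"
        unfolding right_ann_order_sup[OF A] right_ann_order_sup[OF inter]
        using b by (simp add: right_ann_ideals_def)
    qed
    moreover have "(\<lambda>a. a \<sqinter>\<^bsub>?L\<^esub> b) ` A = (\<lambda>a. a \<inter> b) ` A"
      using A b by (intro image_cong) (auto simp: right_ann_order_meet)
    ultimately show "\<Squnion>\<^bsub>?L\<^esub> A \<sqinter>\<^bsub>?L\<^esub> b = \<Squnion>\<^bsub>?L\<^esub> ((\<lambda>a. a \<sqinter>\<^bsub>?L\<^esub> b) ` A)"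
      using right_ann_order_meet[OF sup b] by simp
  qed
qed

end
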